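(* Consider the system, basis functions, data and data matrices described in the context, and assume Assumptions (A1), (A2), (A3) stated there. Let $r>0$ be such that $\mathcal{B}_r\subseteq\mathbb{X}$, and let $\bar{\mathcal{Q}}$ be the finite vertex set defined in the context. Suppose there exist a symmetric matrix $\bar\Gamma\in\mathbb{R}^{n\times n}$ with $\bar\Gamma\succ0$, a real number $\epsilon_{\bar\Gamma}>0$ and a matrix $\bar Y\in\mathbb{R}^{m\times n}$ such that $$\begin{bmatrix}-\bar\Gamma-\mathbf{C} & 0 & \mathbf{B} \\ 0 & -\bar\Gamma+\epsilon_{\bar\Gamma}I_n & -\begin{bmatrix}\bar\Gamma \\ \bar Y\end{bmatrix}^\top Q^\top \\ \mathbf{B}^\top & -Q\begin{bmatrix}\bar\Gamma \\ \bar Y\end{bmatrix} & -\mathbf{A}\end{bmatrix}\preceq0\qquad\text{for all }Q\in\bar{\mathcal{Q}},$$ and let $K=\bar Y\bar\Gamma^{-1}$. Consider the disturbed closed-loop system $$x^{+}=(A(x)+B(x)K)x+w,\qquad w\in\mathbb{R}^n .$$ Define $$\gamma_{A_{\rm cl}}=\max_{x\in\mathcal{B}_r}\|A(x)+B(x)K\|,\qquad \bar\delta_{x_0}=\frac{2\lambda_{\max}^2(\bar\Gamma)-\epsilon_{\bar\Gamma}\lambda_{\min}(\bar\Gamma)}{2\lambda_{\min}(\bar\Gamma)\lambda_{\max}(\bar\Gamma)},$$ $$\bar\delta_w=\frac{4\gamma_{A_{\rm cl}}^2\lambda_{\max}^5(\bar\Gamma)+2\epsilon_{\bar\Gamma}\lambda_{\min}(\bar\Gamma)\lambda_{\max}^3(\bar\Gamma)}{\epsilon_{\bar\Gamma}^2\lambda_{\min}^3(\bar\Gamma)}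 .$$ Then there exist $\bar\beta\in\mathcal{KL}$ and $\bar\gamma\in\mathcal{K}$ such that, for every initial state $x(0)$ and disturbance sequence $\{w(k)\}_{k\ge0}$ satisfying $$|x(0)|^2\le r^2\quad\text{and}\quad\bar\delta_{x_0}|x(0)|^2+\bar\delta_w|w|_\infty^2\le r^2,$$ the corresponding solution satisfies $$|x(k)|\le\bar\beta(|x(0)|,k)+\bar\gamma(|w|_\infty)\qquad\text{for all }k\in\mathbb{N}.$$
   Context: System: $n,m\ge1$; $\mathbb{X}\subseteq\mathbb{R}^n$ contains the origin; $A(x)=[a_{ij}(x)]_{n\times n}$, $B(x)=[b_{ij}(x)]_{n\times m}$ with entries continuous on $\mathbb{X}$; discrete-time system $x^{+}=A(x)x+B(x)u$, $x^{+}(k)=x(k+1)$, $k\in\mathbb{N}=\{0,1,2,\dots\}$. Assumption (A1): there are known functions $\xi_{A_j}:\mathbb{R}^n\to\mathbb{R}^{n_{A_j}}$ ($j=1,\dots,n$) and $\xi_{B_j}:\mathbb{R}^n\to\mathbb{R}^{n_{B_j}}$ ($j=1,\dots,m$), continuous on $\mathbb{X}$, and (unknown) constant matrices $E_{A_j}\in\mathbb{R}^{n\times n_{A_j}}$, $E_{B_j}\in\mathbb{R}^{n\times n_{B_j}}$ such that the $j$-th column of $A(x)$ equals $E_{A_j}\xi_{A_j}(x)$ and the $j$-th column of $B(x)$ equals $E_{B_j}\xi_{B_j}(x)$. Put $E_A=[E_{A_1}\cdots E_{A_n}]$, $E_B=[E_{B_1}\cdots E_{B_m}]$, $n_A=\sum_j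 n_{A_j}$, $n_B=\sum_j n_{B_j}$, $\Xi_A(x)=\mathrm{blkdiag}(\xi_{A_1}(x),\dots,\xi_{A_n}(x))$, $\Xi_B(x)=\mathrm{blkdiag}(\xi_{B_1}(x),\dots,\xi_{B_m}(x))$ (each $\xi$ a column vector block), so $A(x)=E_A\Xi_A(x)$, $B(x)=E_B\Xi_B(x)$. Data: for $k=0,\dots,T-1$ ($T\geq 1$), inputs $u_d(k)$, states $x_d(k)$ and noise $d(k)\in\mathbb{R}^n$ satisfy $x_d(k+1)=E_A\Xi_A(x_d(k))x_d(k)+E_B\Xi_B(x_d(k))u_d(k)+d(k)$. Data matrices: $X_0=[\Xi_A(x_d(0))x_d(0)\ \cdots\ \Xi_A(x_d(T-1))x_d(T-1)]$, $X_1=[x_d(1)\cdots x_d(T)]$, $U_0=[\Xi_B(x_d(0))u_d(0)\cdots\Xi_B(x_d(T-1))u_d(T-1)]$, $D_0=[d(0)\cdots d(T-1)]$, so $X_1=E_AX_0+E_BU_0+D_0$. Assumption (A2): a matrix $\Theta\succeq0$ is known with $D_0D_0^\top\preceq\Theta$. Assumption (A3): $\begin{bmatrix}X_0 \\ U_0\end{bmatrix}$ has full row rank. Define $\mathbf{A}=\begin{bmatrix}X_0 \\ U_0\end{bmatrix}\begin{bmatrix}X_0 \\ U_0\end{bmatrix}^\top$, $\mathbf{B}=-X_1\begin{bmatrix}X_0 \\ U_0\end{bmatrix}^\top$, $\mathbf{C}=X_1X_1^\top-\Theta$. Vertex set: let $\xi^A_{ij}$ and $\xi^B_{ij}$ be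 the $i$-th entries of $\xi_{A_j}$ and $\xi_{B_j}$, and let $\bar\xi^A_{ij},\underline\xi^A_{ij}$ (resp. $\bar\xi^B_{ij},\underline\xi^B_{ij}$) be the maximum and minimum of $\xi^A_{ij}$ (resp. $\xi^B_{ij}$) over $\mathcal{B}_r$. Then $\bar{\mathcal{Q}}$ is the finite set of all matrices $\mathrm{blkdiag}(\zeta_{A_1},\dots,\zeta_{A_n},\zeta_{B_1},\dots,\zeta_{B_m})\in\mathbb{R}^{(n_A+n_B)\times(n+m)}$ where $\zeta_{A_j}\in\mathbb{R}^{n_{A_j}}$ has $i$-th entry in $\{\bar\xi^A_{ij},\underline\xi^A_{ij}\}$ and $\zeta_{B_j}\in\mathbb{R}^{n_{B_j}}$ has $i$-th entry in $\{\bar\xi^B_{ij},\underline\xi^B_{ij}\}$. Notation: $|\cdot|$ is the Euclidean norm of a vector and $\|\cdot\|$ the induced 2-norm of a matrix; $|w|_\infty=\sup_{k\ge0}|w(k)|$; $\mathcal{B}_r=\{x\in\mathbb{R}^n:|x|\le r\}$; $\lambda_{\max},\lambda_{\min}$ are extreme eigenvalues of a symmetric matrix; $\succ,\succeq,\preceq$ denote the Loewner order. Comparison functions: $\gamma:[0,\infty)\to[0,\infty)$ is of class $\mathcal{K}$ if it is continuous, strictly increasing and $\gamma(0)=0$; $\beta:[0,\infty)\times[0,\infty)\to[0,\infty)$ is of class $\mathcal{KL}$ if $\beta(\cdot,t)\in\mathcal{K}$ for each fixed $t$ and, for each fixed $s>0$, $\beta(s,\cdot)$ is continuous, strictly decreasing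 and tends to $0$ at infinity. The claim includes that the solution remains in $\mathbb{X}$, so that it is defined for all $k$. *)

theory Defs
  imports "HOL-Analysis.Analysis"
begin

definition symmetric_mat :: "real^'k^'k \<Rightarrow> bool" where
  "symmetric_mat M \<longleftrightarrow> transpose M = M"

definition loewner_le :: "real^'k^'k \<Rightarrow> real^'k^'k \<Rightarrow> bool" where
  "loewner_le M N \<longleftrightarrow> symmetric_mat (N - M) \<and> (\<forall>v. 0 \<le> v \<bullet> ((N - M) *v v))"

definition loewner_less :: "real^'k^'k \<Rightarrow> real^'k^'k \<Rightarrow> bool" where
  "loewner_less M N \<longleftrightarrow> symmetric_mat (N - M) \<and> (\<forall>v. v \<noteq> 0 \<longrightarrow> 0 < v \<bullet> ((N - M) *v v))"

definition eigenvalues :: "real^'k^'k \<Rightarrow> real set" where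
  "eigenvalues M = {l. \<exists>v. v \<noteq> 0 \<and> M *v v = l *\<^sub>R v}"

(* Intended for symmetric matrices, whose set of real eigenvalues is finite and nonempty. *)
definition lambda_max :: "real^'k^'k \<Rightarrow> real" where
  "lambda_max M = Max (eigenvalues M)"

definition lambda_min :: "real^'k^'k \<Rightarrow> real" where
  "lambda_min M = Min (eigenvalues M)"

definition vcat :: "real^'c^'a \<Rightarrow> real^'c^'b \<Rightarrow> real^'c^('a + 'b)" where
  "vcat M N = (\<chi> i. case i of Inl a \<Rightarrow> M $ a | Inr b \<Rightarrow> N $ b)"

definition hcat :: "real^'a^'r \<Rightarrow> real^'b^'r \<Rightarrow> real^('a + 'b)^'r" where
  "hcat M N = (\<chi> i j. case j of Inl a \<Rightarrow> M $ i $ a | Inr b \<Rightarrow> N $ i $ b)"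

(* A family of column vectors z_j of (possibly different) lengths is stored as one stacked
   vector z over an index type 'p; the map blk sends each index to the j of the block that it
   belongs to, so the length of z_j is card {p. blk p = j}.
   blkdiag blk z is the block-diagonal matrix with the column blocks z_j. *)
definition blkdiag :: "('p \<Rightarrow> 'j) \<Rightarrow> real^'p \<Rightarrow> real^'j^'p" where
  "blkdiag blk z = (\<chi> p j. if blk p = j then z $ p else 0)"

(* The j-th column of F(x) is E_j * xi_j(x) for all x in X, where E_j consists of the columns
   of E = [E_1 ... ] belonging to block j. *)
definition column_representation ::
  "(real^'n) set \<Rightarrow> (real^'n \<Rightarrow> real^'j^'n) \<Rightarrow> ('p \<Rightarrow> 'j) \<Rightarrow> (real^'n \<Rightarrow> real^'p) \<Rightarrow> real^'p^'n \<Rightarrow> bool" where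
  "column_representation X F blk \<xi> E \<longleftrightarrow>
     (\<forall>x\<in>X. \<forall>j. column j (F x) = (\<Sum>p | blk p = j. \<xi> x $ p *\<^sub>R column p E))"

(* Max and min over the closed ball: the entries of xi are continuous there, so the
   supremum and the infimum are attained. *)
definition ball_max :: "real \<Rightarrow> (real^'n \<Rightarrow> real^'p) \<Rightarrow> 'p \<Rightarrow> real" where
  "ball_max r \<xi> p = (SUP x\<in>cball 0 r. \<xi> x $ p)"

definition ball_min :: "real \<Rightarrow> (real^'n \<Rightarrow> real^'p) \<Rightarrow> 'p \<Rightarrow> real" where
  "ball_min r \<xi> p = (INF x\<in>cball 0 r. \<xi> x $ p)"

definition vertex_vectors :: "real \<Rightarrow> (real^'n \<Rightarrow> real^'p) \<Rightarrow> (real^'p) set" where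
  "vertex_vectors r \<xi> = {\<zeta>. \<forall>p. \<zeta> $ p \<in> {ball_max r \<xi> p, ball_min r \<xi> p}}"

definition vertex_matrices ::
  "real \<Rightarrow> ('a \<Rightarrow> 'n::finite) \<Rightarrow> (real^'n \<Rightarrow> real^'a) \<Rightarrow> ('b \<Rightarrow> 'm::finite) \<Rightarrow> (real^'n \<Rightarrow> real^'b)
     \<Rightarrow> (real^('n + 'm)^('a + 'b)) set" where
  "vertex_matrices r blkA \<xi>A blkB \<xi>B =
     {vcat (hcat (blkdiag blkA \<zeta>A) 0) (hcat 0 (blkdiag blkB \<zeta>B)) | \<zeta>A \<zeta>B.
        \<zeta>A \<in> vertex_vectors r \<xi>A \<and> \<zeta>B \<in> vertex_vectors r \<xi>B}"

definition class_K :: "(real \<Rightarrow> real) \<Rightarrow> bool" where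
  "class_K g \<longleftrightarrow> continuous_on {0..} g \<and> strict_mono_on {0..} g \<and> g 0 = 0"

definition class_KL :: "(real \<Rightarrow> real \<Rightarrow> real) \<Rightarrow> bool" where
  "class_KL b \<longleftrightarrow>
     (\<forall>t\<ge>0. class_K (\<lambda>s. b s t)) \<and>
     (\<forall>s>0. continuous_on {0..} (b s) \<and> strict_antimono_on {0..} (b s) \<and> (b s \<longlongrightarrow> 0) at_top)"

(* The real supremum is meaningful for bounded sequences only. *)
definition sup_norm :: "(nat \<Rightarrow> real^'n) \<Rightarrow> real" where
  "sup_norm w = (SUP k. norm (w k))"

end

theory Submission
  imports Defs
begin

text \<open>The Lyapunov function is \<open>V x = x \<bullet> \<Gamma>\<^sup>-\<^sup>1 x\<close>. Evaluating the matrix inequality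
  at the test vector \<open>(a, b, - Z\<^sup>T a)\<close> with \<open>Z = [E\<^sub>A E\<^sub>B]\<close> eliminates the data, and the
  choice \<open>a = \<Gamma>\<^sup>-\<^sup>1 A\<^sub>c\<^sub>l x\<close>, \<open>b = \<Gamma>\<^sup>-\<^sup>1 x\<close> yields
  \<open>V (A\<^sub>c\<^sub>l x) \<le> V x - \<epsilon> |\<Gamma>\<^sup>-\<^sup>1 x|\<^sup>2\<close> on the ball. Young's inequality for the cross term then gives
  \<open>V x\<^sup>+ \<le> \<rho> V x + c |w|\<^sup>2\<close> with \<open>\<rho> = 1 - \<epsilon> \<lambda>\<^sub>m\<^sub>i\<^sub>n / (2 \<lambda>\<^sub>m\<^sub>a\<^sub>x\<^sup>2)\<close>. The constants of the
  theorem are exactly those for which one step of this recursion stays in the ball: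
  \<open>\<delta>\<^sub>x\<^sub>0 = \<rho> \<lambda>\<^sub>m\<^sub>a\<^sub>x / \<lambda>\<^sub>m\<^sub>i\<^sub>n\<close> and \<open>\<delta>\<^sub>w = c \<lambda>\<^sub>m\<^sub>a\<^sub>x / (1 - \<rho>)\<close>.\<close>

section \<open>Quadratic forms and extreme eigenvalues of symmetric matrices\<close>

lemma symmetric_mat_inner:
  fixes M :: "real^'k^'k"
  assumes "symmetric_mat M"
  shows "x \<bullet> (M *v y) = (M *v x) \<bullet> y"
  using assms unfolding symmetric_mat_def
  by (metis dot_lmul_matrix vector_transpose_matrix)

text \<open>The quadratic is evaluated at its extremal point \<open>- b / c\<close>. The cases
  \<open>c = 0\<close> and \<open>c < 0\<close> are settled first: a sloped line or a downward
  parabola is negative somewhere.\<close>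

lemma discriminant_nonpos:
  fixes a b c :: real
  assumes "\<And>t. 0 \<le> a + 2 * b * t + c * t\<^sup>2"
  shows "b\<^sup>2 \<le> a * c"
proof (cases "c = 0")
  case True
  have "b = 0"
  proof (rule ccontr)
    assume "b \<noteq> 0"
    \<comment> \<open>At this point the line takes the value -1.\<close>
    with assms[of "- (a + 1) / (2 * b)"] True show False
      by simp
  qed
  with True show ?thesis by simp
next
  case False
  have "0 \<le> c"
  proof (rule ccontr)
    assume "\<not> 0 \<le> c"
    moreover have "0 \<le> a" using assms[of 0] by simp
    \<comment> \<open>Adding the values at \<open>t\<close> and \<open>- t\<close> cancels the
      linear term and leaves \<open>2 * a - 2 * (a + 1)\<close>, which is negative.\<close>
    moreover define t where "t = sqrt ((a + 1) / (- c))"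
    ultimately have "c * t\<^sup>2 = - (a + 1)" by (simp add: divide_simps)
    moreover have "0 \<le> a + 2 * b * t + c * t\<^sup>2" "0 \<le> a + 2 * b * (- t) + c * (- t)\<^sup>2"
      by (rule assms)+
    ultimately show False by simp
  qed
  with False have c: "c > 0" by simp
  have "0 \<le> (a + 2 * b * (- b / c) + c * (- b / c)\<^sup>2) * c"
    using assms[of "- b / c"] c by (intro mult_nonneg_nonneg) auto
  also have "\<dots> = a * c - b\<^sup>2"
    using c by (simp add: field_simps power2_eq_square)
  finally show ?thesis by simp
qed

lemma psd_Cauchy_Schwarz:
  fixes M :: "real^'k^'k"
  assumes sym: "symmetric_mat M" and psd: "\<And>v. 0 \<le> v \<bullet> (M *v v)"
  shows "(x \<bullet> (M *v y))\<^sup>2 \<le> (x \<bullet> (M *v x)) * (y \<bullet> (M *v y))"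
proof (rule discriminant_nonpos)
  fix t :: real
  have "0 \<le> (x + t *\<^sub>R y) \<bullet> (M *v (x + t *\<^sub>R y))" by (rule psd)
  also have "\<dots> = x \<bullet> (M *v x) + 2 * (x \<bullet> (M *v y)) * t + (y \<bullet> (M *v y)) * t\<^sup>2"
    using symmetric_mat_inner[OF sym, of x y]
    by (simp add: matrix_vector_right_distrib matrix_vector_mult_scaleR inner_add_left
        inner_add_right power2_eq_square algebra_simps inner_commute)
  finally show "0 \<le> x \<bullet> (M *v x) + 2 * (x \<bullet> (M *v y)) * t + (y \<bullet> (M *v y)) * t\<^sup>2" .
qed

text \<open>Eigenvectors of distinct eigenvalues are orthogonal, and pairwise orthogonal sets are
  finite. Without finiteness, \<open>Max\<close> and \<open>Min\<close> in \<open>lambda_max\<close>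
  and \<open>lambda_min\<close> would carry no information.\<close>

lemma finite_eigenvalues:
  fixes M :: "real^'k^'k"
  assumes sym: "symmetric_mat M"
  shows "finite (eigenvalues M)"
proof -
  define f where "f l = (SOME v. v \<noteq> 0 \<and> M *v v = l *\<^sub>R v)" for l
  have f: "f l \<noteq> 0 \<and> M *v f l = l *\<^sub>R f l" if "l \<in> eigenvalues M" for l
    using someI_ex[of "\<lambda>v. v \<noteq> 0 \<and> M *v v = l *\<^sub>R v"] that
    unfolding eigenvalues_def f_def by blast
  have orth: "f l \<bullet> f m = 0" if "l \<in> eigenvalues M" "m \<in> eigenvalues M" "l \<noteq> m" for l m
  proof -
    have "m * (f l \<bullet> f m) = l * (f l \<bullet> f m)"
      using symmetric_mat_inner[OF sym, of "f l" "f m"] f that by simp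
    with that show ?thesis by simp
  qed
  have "pairwise orthogonal (f ` eigenvalues M)"
    unfolding pairwise_def orthogonal_def using orth by blast
  then have "finite (f ` eigenvalues M)" by (rule pairwise_orthogonal_imp_finite)
  moreover have "inj_on f (eigenvalues M)"
  proof (rule inj_onI)
    fix l m assume lm: "l \<in> eigenvalues M" "m \<in> eigenvalues M" "f l = f m"
    show "l = m"
    proof (rule ccontr)
      assume "l \<noteq> m"
      from orth[OF lm(1,2) this] lm f show False by auto
    qed
  qed
  ultimately show ?thesis by (rule finite_imageD)
qed

text \<open>The form attains its maximum \<open>l\<close> over the compact unit sphere. Then
  \<open>l *\<^sub>R mat 1 - M\<close> is positive semidefinite with a form vanishing at the
  maximiser, and Cauchy-Schwarz puts the maximiser into its kernel.\<close>

lemma maximal_eigenvalue_exists: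
  fixes M :: "real^'k^'k"
  assumes sym: "symmetric_mat M"
  shows "\<exists>l\<in>eigenvalues M. \<forall>v. v \<bullet> (M *v v) \<le> l * (norm v)\<^sup>2"
proof -
  let ?S = "sphere (0::real^'k) 1"
  have "continuous_on ?S (\<lambda>v. v \<bullet> (M *v v))"
    by (intro continuous_intros)
  moreover have "?S \<noteq> {}" by simp
  ultimately obtain v where v: "norm v = 1"
    and max: "\<And>u. norm u = 1 \<Longrightarrow> u \<bullet> (M *v u) \<le> v \<bullet> (M *v v)"
    using continuous_attains_sup[OF compact_sphere, of 0 1 "\<lambda>v. v \<bullet> (M *v v)"] by auto
  define l where "l = v \<bullet> (M *v v)"
  have bound: "u \<bullet> (M *v u) \<le> l * (norm u)\<^sup>2" for u
  proof (cases "u = 0")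
    case False
    then have "u \<bullet> (M *v u) / (norm u)\<^sup>2 \<le> l"
      using max[of "u /\<^sub>R norm u"] unfolding l_def
      by (simp add: matrix_vector_mult_scaleR power2_eq_square divide_simps)
    with False show ?thesis by (simp add: divide_simps mult.commute)
  qed simp
  define N where "N = l *\<^sub>R mat 1 - M"
  have Nv: "N *v u = l *\<^sub>R u - M *v u" for u
    unfolding N_def by (simp add: matrix_vector_mult_diff_rdistrib flip: scaleR_matrix_vector_assoc)
  have "symmetric_mat N"
    using sym unfolding symmetric_mat_def N_def
    by (simp add: transpose_def vec_eq_iff mat_def)
  moreover have "0 \<le> u \<bullet> (N *v u)" for u
    using bound[of u] by (simp add: Nv inner_diff_right power2_norm_eq_inner)
  ultimately have "((N *v v) \<bullet> (N *v v))\<^sup>2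
      \<le> ((N *v v) \<bullet> (N *v (N *v v))) * (v \<bullet> (N *v v))"
    by (rule psd_Cauchy_Schwarz)
  also have "v \<bullet> (N *v v) = 0"
    using v by (simp add: Nv inner_diff_right l_def norm_eq_1)
  finally have "N *v v = 0" by simp
  then have "M *v v = l *\<^sub>R v" by (simp add: Nv)
  with v have "l \<in> eigenvalues M" unfolding eigenvalues_def by (auto intro!: exI[of _ v])
  with bound show ?thesis by blast
qed

lemma minimal_eigenvalue_exists:
  fixes M :: "real^'k^'k"
  assumes sym: "symmetric_mat M"
  shows "\<exists>l\<in>eigenvalues M. \<forall>v. l * (norm v)\<^sup>2 \<le> v \<bullet> (M *v v)"
proof -
  have neg: "(- M) *v v = - (M *v v)" for v
    by (simp add: vec_eq_iff matrix_vector_mult_def sum_negf)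
  have "symmetric_mat (- M)"
    using sym unfolding symmetric_mat_def by (simp add: transpose_def vec_eq_iff)
  then obtain l where "l \<in> eigenvalues (- M)" and l: "\<And>v. v \<bullet> ((- M) *v v) \<le> l * (norm v)\<^sup>2"
    using maximal_eigenvalue_exists by blast
  then have "- l \<in> eigenvalues M"
    unfolding eigenvalues_def by (simp add: neg) (metis minus_equation_iff)
  moreover have "- l * (norm v)\<^sup>2 \<le> v \<bullet> (M *v v)" for v
    using l[of v] by (simp add: neg)
  ultimately show ?thesis by blast
qed

lemma lambda_max_upper:
  fixes M :: "real^'k^'k"
  assumes sym: "symmetric_mat M"
  shows "v \<bullet> (M *v v) \<le> lambda_max M * (norm v)\<^sup>2"
proof -
  obtain l where l: "l \<in> eigenvalues M" "v \<bullet> (M *v v) \<le> l * (norm v)\<^sup>2"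
    using maximal_eigenvalue_exists[OF sym] by blast
  then have "l \<le> lambda_max M"
    unfolding lambda_max_def using finite_eigenvalues[OF sym] by simp
  then have "l * (norm v)\<^sup>2 \<le> lambda_max M * (norm v)\<^sup>2" by (intro mult_right_mono) auto
  with l show ?thesis by simp
qed

lemma lambda_min_lower:
  fixes M :: "real^'k^'k"
  assumes sym: "symmetric_mat M"
  shows "lambda_min M * (norm v)\<^sup>2 \<le> v \<bullet> (M *v v)"
proof -
  obtain l where l: "l \<in> eigenvalues M" "l * (norm v)\<^sup>2 \<le> v \<bullet> (M *v v)"
    using minimal_eigenvalue_exists[OF sym] by blast
  then have "lambda_min M \<le> l"
    unfolding lambda_min_def using finite_eigenvalues[OF sym] by simp
  then have "lambda_min M * (norm v)\<^sup>2 \<le> l * (norm v)\<^sup>2" by (intro mult_right_mono) auto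
  with l show ?thesis by simp
qed

lemma lambda_min_le_lambda_max:
  fixes M :: "real^'k^'k"
  assumes sym: "symmetric_mat M"
  shows "lambda_min M \<le> lambda_max M"
  using maximal_eigenvalue_exists[OF sym] finite_eigenvalues[OF sym]
  unfolding lambda_min_def lambda_max_def by (meson Max_ge Min_le order_trans)

lemma lambda_min_attained:
  fixes M :: "real^'k^'k"
  assumes sym: "symmetric_mat M"
  obtains v where "v \<noteq> 0" "M *v v = lambda_min M *\<^sub>R v"
proof -
  have "lambda_min M \<in> eigenvalues M"
    unfolding lambda_min_def
    using finite_eigenvalues[OF sym] minimal_eigenvalue_exists[OF sym] by (intro Min_in) auto
  then show thesis using that unfolding eigenvalues_def by blast
qed

text \<open>Cauchy-Schwarz for the form of \<open>M\<close> at \<open>y\<close> and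
  \<open>M *v y\<close>, with one factor \<open>(norm (M *v y))\<^sup>2\<close> cancelled. With
  \<open>y = P *v v\<close> and \<open>P\<close> inverse to \<open>M\<close>, this bounds the
  Lyapunov function from below.\<close>

lemma norm_psd_mult_le:
  fixes M :: "real^'k^'k"
  assumes sym: "symmetric_mat M" and psd: "\<And>v. 0 \<le> v \<bullet> (M *v v)"
  shows "(norm (M *v y))\<^sup>2 \<le> lambda_max M * (y \<bullet> (M *v y))"
proof (cases "M *v y = 0")
  case True
  then show ?thesis by simp
next
  case False
  let ?n = "(norm (M *v y))\<^sup>2"
  have "?n * ?n = (y \<bullet> (M *v (M *v y)))\<^sup>2"
    unfolding symmetric_mat_inner[OF sym, of y "M *v y"]
    by (simp only: power2_norm_eq_inner) (simp only: power2_eq_square)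
  also have "\<dots> \<le> (y \<bullet> (M *v y)) * ((M *v y) \<bullet> (M *v (M *v y)))"
    by (rule psd_Cauchy_Schwarz[OF sym psd])
  also have "\<dots> \<le> (y \<bullet> (M *v y)) * (lambda_max M * ?n)"
    by (intro mult_left_mono lambda_max_upper sym psd)
  finally have "?n * ?n \<le> (lambda_max M * (y \<bullet> (M *v y))) * ?n" by (simp add: mult_ac)
  moreover have "0 < ?n" using False by simp
  ultimately show ?thesis by (rule mult_right_le_imp_le)
qed

section \<open>Block vectors, block matrices and the column representation\<close>

definition vapp :: "real^'a \<Rightarrow> real^'b \<Rightarrow> real^('a + 'b)" where
  "vapp u v = (\<chi> i. case i of Inl a \<Rightarrow> u $ a | Inr b \<Rightarrow> v $ b)"

lemma sum_UNIV_Plus: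
  fixes f :: "'a::finite + 'b::finite \<Rightarrow> real"
  shows "sum f UNIV = (\<Sum>a\<in>UNIV. f (Inl a)) + (\<Sum>b\<in>UNIV. f (Inr b))"
  using sum.Plus[of UNIV UNIV f] by (simp add: UNIV_Plus_UNIV)

lemma inner_vapp [simp]: "vapp u v \<bullet> vapp u' v' = u \<bullet> u' + v \<bullet> v'"
  by (simp add: inner_vec_def vapp_def sum_UNIV_Plus)

lemma vcat_mult_vec [simp]: "vcat M N *v x = vapp (M *v x) (N *v x)"
  by (auto simp: vec_eq_iff matrix_vector_mult_def vapp_def vcat_def split: sum.split)

lemma hcat_mult_vapp [simp]: "hcat M N *v vapp u v = M *v u + N *v v"
  by (simp add: vec_eq_iff matrix_vector_mult_def vapp_def hcat_def sum_UNIV_Plus)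

lemma minus_mult_vec: "(- M) *v x = - (M *v (x::real^'c))" for M :: "real^'c^'r"
  by (simp add: vec_eq_iff matrix_vector_mult_def sum_negf)

lemma blkdiag_mult_nth: "(blkdiag blk z *v x) $ p = z $ p * x $ blk p"
  by (simp add: blkdiag_def matrix_vector_mult_def if_distrib if_distribR sum.delta cong: if_cong)

text \<open>In column \<open>j\<close>, \<open>blkdiag\<close> keeps exactly the indices of block
  \<open>j\<close>, so the columnwise assumption becomes the factorisation used in the data
  equation.\<close>

lemma column_representation_eq:
  assumes "column_representation X F blk \<xi> E" "x \<in> X"
  shows "F x = E ** blkdiag blk (\<xi> x)"
proof -
  have "F x $ i $ j = (\<Sum>p | blk p = j. \<xi> x $ p * E $ i $ p)" for i j
  proof -
    have "column j (F x) $ i = (\<Sum>p | blk p = j. \<xi> x $ p *\<^sub>R column p E) $ i"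
      using assms unfolding column_representation_def by simp
    then show ?thesis by (simp add: column_def)
  qed
  then show ?thesis
    by (simp add: vec_eq_iff matrix_matrix_mult_def blkdiag_def sum.If_cases if_distrib
        mult.commute cong: if_cong)
qed

lemma inner_transpose_mult:
  fixes M :: "real^'c^'r"
  shows "x \<bullet> (M *v y) = (transpose M *v x) \<bullet> y"
  by (simp add: dot_lmul_matrix flip: vector_transpose_matrix)

section \<open>Basis functions on the ball and the vertex set\<close>

text \<open>Compactness of the ball makes the image bounded, which the real supremum and infimum
  need in order to be bounds at all.\<close>

lemma ball_bounds:
  fixes \<xi> :: "real^'n \<Rightarrow> real^'p"
  assumes "continuous_on X \<xi>" "cball 0 r \<subseteq> X" "x \<in> cball 0 r"
  shows "ball_min r \<xi> p \<le> \<xi> x $ p" "\<xi> x $ p \<le> ball_max r \<xi> p"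
proof -
  have "continuous_on (cball 0 r) (\<lambda>x. \<xi> x $ p)"
    using assms by (intro continuous_intros continuous_on_subset[OF assms(1)]) auto
  then have "compact ((\<lambda>x. \<xi> x $ p) ` cball 0 r)"
    by (intro compact_continuous_image compact_cball)
  then have "bounded ((\<lambda>x. \<xi> x $ p) ` cball 0 r)" by (rule compact_imp_bounded)
  then show "ball_min r \<xi> p \<le> \<xi> x $ p" "\<xi> x $ p \<le> ball_max r \<xi> p"
    unfolding ball_min_def ball_max_def using assms(3)
    by (auto intro!: cINF_lower cSUP_upper bounded_imp_bdd_below bounded_imp_bdd_above)
qed

text \<open>A linear functional on a box is dominated by its value at a vertex; since the vertex may
  depend on the functional, no convex combination of the matrix inequalities is needed.\<close>

lemma vertex_dominates:
  fixes \<xi> :: "real^'n \<Rightarrow> real^'p"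
  assumes "continuous_on X \<xi>" "cball 0 r \<subseteq> X" "x \<in> cball 0 r"
  obtains \<zeta> where "\<zeta> \<in> vertex_vectors r \<xi>"
    "c \<bullet> (blkdiag blk (\<xi> x) *v s) \<le> c \<bullet> (blkdiag blk \<zeta> *v s)"
proof -
  \<comment> \<open>The functional is a sum over \<open>p\<close> of
    \<open>c $ p * s $ blk p\<close> times the entry, so the sign of this coefficient decides each
    endpoint independently.\<close>
  define \<zeta> :: "real^'p" where
    "\<zeta> = (\<chi> p. if c $ p * s $ blk p \<ge> 0 then ball_max r \<xi> p else ball_min r \<xi> p)"
  have "\<zeta> \<in> vertex_vectors r \<xi>" unfolding vertex_vectors_def \<zeta>_def by simp
  moreover have "c \<bullet> (blkdiag blk (\<xi> x) *v s) \<le> c \<bullet> (blkdiag blk \<zeta> *v s)"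
    unfolding inner_vec_def
  proof (rule sum_mono)
    fix p
    have "(c $ p * s $ blk p) * \<xi> x $ p \<le> (c $ p * s $ blk p) * \<zeta> $ p"
      using ball_bounds[OF assms, of p]
      by (auto simp: \<zeta>_def intro: mult_left_mono mult_left_mono_neg)
    then show "c $ p \<bullet> (blkdiag blk (\<xi> x) *v s) $ p \<le> c $ p \<bullet> (blkdiag blk \<zeta> *v s) $ p"
      by (simp add: blkdiag_mult_nth mult_ac)
  qed
  ultimately show thesis by (rule that)
qed

section \<open>The scalar recursion and comparison functions\<close>

text \<open>The decay of \<open>V\<close> is available only inside the ball, so invariance and the
  bound on \<open>V\<close> go through one joint induction. The initial state has its own
  hypothesis, as \<open>\<rho> * \<alpha>2 / \<alpha>1\<close> may be below 1.\<close>

lemma ball_invariance_and_iss_estimate: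
  fixes x w :: "nat \<Rightarrow> 'v::real_normed_vector" and V :: "'v \<Rightarrow> real"
  assumes V: "\<And>v. \<alpha>1 * (norm v)\<^sup>2 \<le> V v" "\<And>v. V v \<le> \<alpha>2 * (norm v)\<^sup>2" and \<alpha>1: "0 < \<alpha>1"
    and \<rho>: "0 < \<rho>" "\<rho> < 1" and c: "0 \<le> c"
    and w: "\<And>k. norm (w k) \<le> W"
    and step: "\<And>k. norm (x k) \<le> r \<Longrightarrow> V (x (Suc k)) \<le> \<rho> * V (x k) + c * (norm (w k))\<^sup>2"
    and r: "0 < r" and x0: "norm (x 0) \<le> r"
    and small: "(\<rho> * \<alpha>2 / \<alpha>1) * (norm (x 0))\<^sup>2 + (c / ((1 - \<rho>) * \<alpha>1)) * W\<^sup>2 \<le> r\<^sup>2"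
  shows "norm (x k) \<le> r \<and> (norm (x k))\<^sup>2
           \<le> (\<alpha>2 / \<alpha>1) * \<rho> ^ k * (norm (x 0))\<^sup>2 + (c / ((1 - \<rho>) * \<alpha>1)) * W\<^sup>2"
proof -
  \<comment> \<open>The fixed point of \<open>s = \<rho> * s + c * W\<^sup>2\<close>, so a bound of
    the form transient plus \<open>b\<close> reproduces itself.\<close>
  define b where "b = c / (1 - \<rho>) * W\<^sup>2"
  have b: "0 \<le> b" using \<rho> c by (simp add: b_def)
  have \<alpha>2: "0 \<le> \<alpha>2 * (norm (x 0))\<^sup>2"
    using V[of "x 0"] \<alpha>1 by (smt (verit) mult_nonneg_nonneg zero_le_power2)
  have sq: "(norm (x k))\<^sup>2 \<le> (\<alpha>2 / \<alpha>1) * \<rho> ^ k * (norm (x 0))\<^sup>2 + (c / ((1 - \<rho>) * \<alpha>1)) * W\<^sup>2"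
    if "V (x k) \<le> \<rho> ^ k * (\<alpha>2 * (norm (x 0))\<^sup>2) + b" for k
  proof -
    have "(norm (x k))\<^sup>2 \<le> (\<rho> ^ k * (\<alpha>2 * (norm (x 0))\<^sup>2) + b) / \<alpha>1"
      using V(1)[of "x k"] that \<alpha>1 by (simp add: pos_le_divide_eq mult.commute)
    also have "\<dots> = (\<alpha>2 / \<alpha>1) * \<rho> ^ k * (norm (x 0))\<^sup>2 + (c / ((1 - \<rho>) * \<alpha>1)) * W\<^sup>2"
      using \<alpha>1 \<rho> by (simp add: b_def add_divide_distrib mult_ac)
    finally show ?thesis .
  qed
  have "norm (x k) \<le> r \<and> V (x k) \<le> \<rho> ^ k * (\<alpha>2 * (norm (x 0))\<^sup>2) + b"
  proof (induction k)
    case 0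
    then show ?case using x0 V(2)[of "x 0"] b by simp
  next
    case (Suc k)
    then have IH: "norm (x k) \<le> r" "V (x k) \<le> \<rho> ^ k * (\<alpha>2 * (norm (x 0))\<^sup>2) + b" by auto
    have "V (x (Suc k)) \<le> \<rho> * V (x k) + c * (norm (w k))\<^sup>2" by (rule step[OF IH(1)])
    also have "\<dots> \<le> \<rho> * (\<rho> ^ k * (\<alpha>2 * (norm (x 0))\<^sup>2) + b) + c * W\<^sup>2"
      using IH(2) \<rho> c w[of k] by (intro add_mono mult_left_mono power_mono) auto
    also have "c * W\<^sup>2 = (1 - \<rho>) * b" using \<rho> by (simp add: b_def)
    finally have V_Suc: "V (x (Suc k)) \<le> \<rho> ^ Suc k * (\<alpha>2 * (norm (x 0))\<^sup>2) + b"
      by (simp add: algebra_simps)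
    \<comment> \<open>The smallness condition contains the factor \<open>\<rho>\<close> of the first
      step; every later step carries a higher power, so the condition covers them all.\<close>
    have "\<rho> ^ Suc k * ((\<alpha>2 / \<alpha>1) * (norm (x 0))\<^sup>2) \<le> \<rho> * ((\<alpha>2 / \<alpha>1) * (norm (x 0))\<^sup>2)"
      using \<rho> \<alpha>1 \<alpha>2 by (intro mult_right_mono) (auto simp: power_le_one mult_left_le)
    with sq[OF V_Suc] small have "(norm (x (Suc k)))\<^sup>2 \<le> r\<^sup>2" by (simp add: mult_ac)
    then have "norm (x (Suc k)) \<le> r" by (rule power2_le_imp_le) (use r in simp)
    with V_Suc show ?case by blast
  qed
  with sq show ?thesis by blast
qed

lemma class_KL_exponential:
  assumes "0 < a" "0 < \<rho>" "\<rho> < 1"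
  shows "class_KL (\<lambda>s t. a * \<rho> powr t * s)"
  unfolding class_KL_def
proof (intro conjI allI impI)
  fix t :: real
  show "class_K (\<lambda>s. a * \<rho> powr t * s)"
    unfolding class_K_def using assms
    by (auto intro!: continuous_intros strict_mono_onI)
next
  fix s :: real assume "0 < s"
  show "continuous_on {0..} (\<lambda>t. a * \<rho> powr t * s)"
    using assms by (auto intro!: continuous_intros)
  show "strict_antimono_on {0..} (\<lambda>t. a * \<rho> powr t * s)"
    using assms \<open>0 < s\<close> by (auto intro!: monotone_onI powr_less_mono')
  have "((\<lambda>t. \<rho> powr t) \<longlongrightarrow> 0) at_top"
  proof -
    \<comment> \<open>\<open>\<rho> powr t\<close> is rewritten as an exponential with negative rate
      \<open>ln \<rho>\<close>.\<close>
    have "((\<lambda>t. exp (- (- ln \<rho> * t))) \<longlongrightarrow> 0) at_top"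
      using assms
      by (intro filterlim_compose[OF exp_at_bot] filterlim_compose[OF filterlim_uminus_at_bot_at_top]
          filterlim_tendsto_pos_mult_at_top[OF tendsto_const _ filterlim_ident]) auto
    with assms show ?thesis by (simp add: powr_def mult.commute)
  qed
  then have "((\<lambda>t. a * \<rho> powr t * s) \<longlongrightarrow> a * 0 * s) at_top" by (intro tendsto_intros)
  then show "((\<lambda>t. a * \<rho> powr t * s) \<longlongrightarrow> 0) at_top" by simp
qed

lemma class_K_linear: "0 < a \<Longrightarrow> class_K (\<lambda>s. a * s)"
  unfolding class_K_def by (auto intro!: continuous_intros strict_mono_onI)

section \<open>Closed-loop gain, matrix inequality and Lyapunov decrease\<close>

text \<open>The operator norm is dominated by the sum of absolute entries, which is continuous. This
  makes the supremum \<open>\<gamma>Acl\<close> a genuine upper bound.\<close>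

lemma bdd_above_onorm_image:
  fixes F :: "'x::topological_space \<Rightarrow> real^'c^'r"
  assumes "compact S" "\<And>i j. continuous_on S (\<lambda>x. F x $ i $ j)"
  shows "bdd_above ((\<lambda>x. onorm (\<lambda>v. F x *v v)) ` S)"
proof -
  let ?h = "\<lambda>x. \<Sum>i\<in>UNIV. \<Sum>j\<in>UNIV. \<bar>F x $ i $ j\<bar>"
  have "continuous_on S ?h" by (intro continuous_intros assms)
  then have "bounded (?h ` S)"
    using assms(1) by (intro compact_imp_bounded compact_continuous_image)
  then obtain B where "\<And>x. x \<in> S \<Longrightarrow> ?h x \<le> B"
    by (meson bdd_above.unfold bounded_imp_bdd_above image_eqI)
  then show ?thesis
    by (intro bdd_aboveI2[of _ _ B] order_trans[OF onorm_le_matrix_component_sum])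
qed

text \<open>At the test vector \<open>(a, b, - Z\<^sup>T a)\<close> the data blocks of the inequality combine to
  \<open>a\<^sup>T (\<Theta> - D D\<^sup>T) a\<close>, which is nonnegative by the noise bound and can be dropped.\<close>

lemma lmi_test_vector:
  fixes W :: "real^'t^'q" and X1 D :: "real^'t^'n" and Z :: "real^'q^'n"
    and Q :: "real^'s^'q" and S :: "real^'n^'s"
  assumes X1: "X1 = Z ** W + D" and D: "loewner_le (D ** transpose D) \<Theta>"
    and lmi: "loewner_le
            (vcat (hcat (- \<Gamma> - (X1 ** transpose X1 - \<Theta>)) (hcat 0 (- (X1 ** transpose W))))
            (vcat (hcat 0 (hcat (- \<Gamma> + \<epsilon> *\<^sub>R mat 1) (- (transpose S ** transpose Q))))
                  (hcat (transpose (- (X1 ** transpose W)))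
                    (hcat (- (Q ** S)) (- (W ** transpose W))))))
            0"
  shows "2 * (a \<bullet> (Z *v (Q *v (S *v b)))) \<le> a \<bullet> (\<Gamma> *v a) + b \<bullet> (\<Gamma> *v b) - \<epsilon> * (b \<bullet> b)"
proof -
  define c where "c = - (transpose Z *v a)"
  \<comment> \<open>In terms of \<open>p\<close> and \<open>q\<close>, the data blocks other than
    \<open>\<Theta>\<close> sum to \<open>- ((p + q) \<bullet> (p + q))\<close>, and
    \<open>X1 = Z ** W + D\<close> collapses \<open>p + q\<close> to
    \<open>transpose D *v a\<close>.\<close>
  define p where "p = transpose X1 *v a"
  define q where "q = transpose W *v c"
  let ?v = "vapp a (vapp b c)"
  have tD: "transpose D *v a = p + q"
  proof -
    have "transpose X1 *v a = transpose W *v (transpose Z *v a) + transpose D *v a"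
      unfolding X1 by (simp add: vec_eq_iff transpose_def matrix_vector_mult_def
          matrix_matrix_mult_def sum.distrib algebra_simps sum_distrib_left sum_distrib_right
          sum.swap[of _ "UNIV::'q set" "UNIV::'n set"])
    then show ?thesis
      using matrix_vector_mult_diff_distrib[of "transpose W" 0 "transpose Z *v a"]
      by (simp add: p_def q_def c_def)
  qed
  have noise: "(p + q) \<bullet> (p + q) \<le> a \<bullet> (\<Theta> *v a)"
  proof -
    have "0 \<le> a \<bullet> ((\<Theta> - D ** transpose D) *v a)"
      using D unfolding loewner_le_def by blast
    then show ?thesis
      by (simp add: matrix_vector_mult_diff_rdistrib inner_diff_right
          inner_transpose_mult[of a D] tD
          del: transpose_matrix_vector flip: matrix_vector_mul_assoc)
  qed
  have XX: "a \<bullet> (X1 *v (transpose X1 *v a)) = p \<bullet> p"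
    by (simp add: inner_transpose_mult[of a X1] p_def)
  have XW: "a \<bullet> (X1 *v (transpose W *v c)) = p \<bullet> q"
    by (simp add: inner_transpose_mult[of a X1] p_def q_def)
  have WX: "c \<bullet> (W *v (transpose X1 *v a)) = p \<bullet> q"
    by (simp add: inner_transpose_mult[of c W] p_def q_def inner_commute)
  have WW: "c \<bullet> (W *v (transpose W *v c)) = q \<bullet> q"
    by (simp add: inner_transpose_mult[of c W] q_def)
  have SQ: "b \<bullet> (transpose S *v (transpose Q *v c)) = c \<bullet> (Q *v (S *v b))"
    by (simp add: dot_lmul_matrix inner_commute[of b])
  \<comment> \<open>The minus sign in \<open>c\<close> moves the two equal cross blocks to the
    desired side as \<open>2 * (a \<bullet> (Z *v (Q *v (S *v b))))\<close>.\<close>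
  have cQ: "c \<bullet> (Q *v (S *v b)) = - (a \<bullet> (Z *v (Q *v (S *v b))))"
    by (simp add: inner_transpose_mult[of a Z] c_def)
  have tXW: "transpose (- (X1 ** transpose W)) = - (W ** transpose X1)"
    by (simp add: vec_eq_iff transpose_def matrix_matrix_mult_def mult.commute)
  show ?thesis
    using lmi[unfolded loewner_le_def, THEN conjunct2, THEN spec, of ?v] noise
    by (simp add: tXW matrix_vector_mult_diff_rdistrib matrix_vector_mult_add_rdistrib
        minus_mult_vec inner_diff_right inner_add_right inner_add_left XX XW WX WW SQ cQ
        inner_commute[of q p]
        del: transpose_matrix_vector
        flip: matrix_vector_mul_assoc scaleR_matrix_vector_assoc)
qed

text \<open>Facts about \<open>P\<close> come from inserting \<open>v = \<Gamma> *v (P *v v)\<close>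
  into facts about \<open>\<Gamma>\<close>, so the spectrum of \<open>P\<close> never enters.
  \<open>M\<close> stands for the closed-loop matrix frozen at one state.\<close>

lemma lyapunov_decrease:
  fixes \<Gamma> M :: "real^'n^'n"
  assumes sym: "symmetric_mat \<Gamma>" and lm: "0 < lambda_min \<Gamma>" and \<epsilon>: "0 < \<epsilon>"
    and inv: "\<Gamma> ** P = mat 1"
    and test: "\<And>a b. 2 * (a \<bullet> (M *v (\<Gamma> *v b))) \<le> a \<bullet> (\<Gamma> *v a) + b \<bullet> (\<Gamma> *v b) - \<epsilon> * (b \<bullet> b)"
    and g: "norm (M *v x) \<le> g * norm x"
  shows "(norm v)\<^sup>2 / lambda_max \<Gamma> \<le> v \<bullet> (P *v v)"
    and "v \<bullet> (P *v v) \<le> (norm v)\<^sup>2 / lambda_min \<Gamma>"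
    and "(M *v x + w) \<bullet> (P *v (M *v x + w))
      \<le> (1 - \<epsilon> * lambda_min \<Gamma> / (2 * (lambda_max \<Gamma>)\<^sup>2)) * (x \<bullet> (P *v x))
        + (2 * (lambda_max \<Gamma>)\<^sup>2 * g\<^sup>2 + \<epsilon> * lambda_min \<Gamma>) / (\<epsilon> * (lambda_min \<Gamma>)\<^sup>2) * (norm w)\<^sup>2"
proof -
  define l L where "l = lambda_min \<Gamma>" and "L = lambda_max \<Gamma>"
  have l: "0 < l" using lm by (simp add: l_def)
  then have L: "0 < L" using lambda_min_le_lambda_max[OF sym] by (simp add: l_def L_def)
  have GP: "\<Gamma> *v (P *v v) = v" for v
    by (simp add: matrix_vector_mul_assoc inv)
  have psd: "0 \<le> v \<bullet> (\<Gamma> *v v)" for v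
    using lambda_min_lower[OF sym, of v] lm by (smt (verit) mult_nonneg_nonneg zero_le_power2)
  have symP: "u \<bullet> (P *v v) = v \<bullet> (P *v u)" for u v
    using symmetric_mat_inner[OF sym, of "P *v u" "P *v v"] by (simp add: GP inner_commute)
  have lower: "(norm v)\<^sup>2 \<le> L * (v \<bullet> (P *v v))" for v
    using norm_psd_mult_le[OF sym psd, of "P *v v"] by (simp add: GP L_def inner_commute)
  have normP: "norm (P *v v) \<le> norm v / l" for v
  proof (cases "P *v v = 0")
    case False
    have "l * (norm (P *v v))\<^sup>2 \<le> (P *v v) \<bullet> v"
      using lambda_min_lower[OF sym, of "P *v v"] by (simp add: GP l_def)
    also have "\<dots> \<le> norm (P *v v) * norm v" by (rule norm_cauchy_schwarz)
    finally have "norm (P *v v) * (l * norm (P *v v)) \<le> norm (P *v v) * norm v"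
      by (simp add: power2_eq_square mult_ac)
    with False l show ?thesis by (simp add: pos_le_divide_eq mult.commute)
  qed (use l in simp)
  have upper: "v \<bullet> (P *v v) \<le> (norm v)\<^sup>2 / l" for v
  proof -
    have "v \<bullet> (P *v v) \<le> norm v * norm (P *v v)" by (rule norm_cauchy_schwarz)
    also have "\<dots> \<le> norm v * (norm v / l)" by (intro mult_left_mono normP) auto
    finally show ?thesis by (simp add: power2_eq_square)
  qed
  show "(norm v)\<^sup>2 / lambda_max \<Gamma> \<le> v \<bullet> (P *v v)"
    using lower[of v] L by (simp add: pos_divide_le_eq mult.commute L_def)
  show "v \<bullet> (P *v v) \<le> (norm v)\<^sup>2 / lambda_min \<Gamma>"
    using upper[of v] by (simp add: l_def)
  let ?y = "M *v x"
  \<comment> \<open>At \<open>a = P *v ?y\<close> and \<open>b = P *v x\<close> the left side of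
    \<open>test\<close> is twice the new value of the form and the right side contains it
    once.\<close>
  have decrease: "?y \<bullet> (P *v ?y) \<le> x \<bullet> (P *v x) - \<epsilon> * (norm (P *v x))\<^sup>2"
    using test[of "P *v ?y" "P *v x"]
    by (simp add: GP power2_norm_eq_inner inner_commute)
  have "(norm x)\<^sup>2 \<le> L * ((P *v x) \<bullet> (\<Gamma> *v (P *v x)))"
    using lower[of x] by (simp add: GP inner_commute)
  also have "\<dots> \<le> L * (L * (norm (P *v x))\<^sup>2)"
    unfolding L_def using L by (intro mult_left_mono lambda_max_upper sym) (simp add: L_def)
  finally have "(norm x)\<^sup>2 \<le> L\<^sup>2 * (norm (P *v x))\<^sup>2" by (simp add: power2_eq_square mult_ac)
  then have "\<epsilon> * ((norm x)\<^sup>2 / L\<^sup>2) \<le> \<epsilon> * (norm (P *v x))\<^sup>2"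
    using L \<epsilon> by (intro mult_left_mono) (simp_all add: pos_divide_le_eq mult.commute)
  with decrease have decrease': "?y \<bullet> (P *v ?y) \<le> x \<bullet> (P *v x) - \<epsilon> / L\<^sup>2 * (norm x)\<^sup>2" by simp
  have "?y \<bullet> (P *v w) \<le> norm ?y * norm (P *v w)" by (rule norm_cauchy_schwarz)
  also have "\<dots> \<le> (g * norm x) * (norm w / l)"
    using g normP by (intro mult_mono) (auto intro: order_trans[OF norm_ge_zero g])
  finally have cross: "2 * (?y \<bullet> (P *v w)) \<le> 2 * g * norm x * norm w / l" by simp
  also have "\<dots> \<le> \<epsilon> / (2 * L\<^sup>2) * (norm x)\<^sup>2 + 2 * L\<^sup>2 * g\<^sup>2 / (\<epsilon> * l\<^sup>2) * (norm w)\<^sup>2"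
  proof -
    \<comment> \<open>The weight spends exactly half of the decrease
      \<open>\<epsilon> / L\<^sup>2 * (norm x)\<^sup>2\<close> on the cross term; hence the factor 2
      in the contraction rate.\<close>
    have "0 \<le> (\<epsilon> * l * norm x - 2 * L\<^sup>2 * g * norm w)\<^sup>2 / (2 * L\<^sup>2 * \<epsilon> * l\<^sup>2)"
      using L l \<epsilon> by simp
    also have "\<dots> = \<epsilon> / (2 * L\<^sup>2) * (norm x)\<^sup>2 + 2 * L\<^sup>2 * g\<^sup>2 / (\<epsilon> * l\<^sup>2) * (norm w)\<^sup>2
        - 2 * g * norm x * norm w / l"
      using L l \<epsilon> by (simp add: field_simps power2_eq_square)
    finally show ?thesis by simp
  qed
  finally have young: "2 * (?y \<bullet> (P *v w))
      \<le> \<epsilon> / (2 * L\<^sup>2) * (norm x)\<^sup>2 + 2 * L\<^sup>2 * g\<^sup>2 / (\<epsilon> * l\<^sup>2) * (norm w)\<^sup>2" .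
  \<comment> \<open>The other half of the decrease is turned into a multiple of the Lyapunov
    function.\<close>
  have "\<epsilon> / (2 * L\<^sup>2) * (l * (x \<bullet> (P *v x))) \<le> \<epsilon> / (2 * L\<^sup>2) * (norm x)\<^sup>2"
    using upper[of x] l \<epsilon> by (intro mult_left_mono) (simp_all add: pos_le_divide_eq mult.commute)
  then have state: "\<epsilon> * l / (2 * L\<^sup>2) * (x \<bullet> (P *v x)) \<le> \<epsilon> / (2 * L\<^sup>2) * (norm x)\<^sup>2"
    by simp
  have "(?y + w) \<bullet> (P *v (?y + w)) = ?y \<bullet> (P *v ?y) + 2 * (?y \<bullet> (P *v w)) + w \<bullet> (P *v w)"
    using symP[of w ?y] by (simp add: matrix_vector_right_distrib inner_add_left inner_add_right)
  also have "\<dots> \<le> (x \<bullet> (P *v x) - \<epsilon> / L\<^sup>2 * (norm x)\<^sup>2)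
      + (\<epsilon> / (2 * L\<^sup>2) * (norm x)\<^sup>2 + 2 * L\<^sup>2 * g\<^sup>2 / (\<epsilon> * l\<^sup>2) * (norm w)\<^sup>2) + (norm w)\<^sup>2 / l"
    by (intro add_mono decrease' young upper)
  also have "\<dots> = x \<bullet> (P *v x) - \<epsilon> / (2 * L\<^sup>2) * (norm x)\<^sup>2
      + (2 * L\<^sup>2 * g\<^sup>2 + \<epsilon> * l) / (\<epsilon> * l\<^sup>2) * (norm w)\<^sup>2"
    using L l \<epsilon> by (simp add: field_simps power2_eq_square)
  also have "\<dots> \<le> x \<bullet> (P *v x) - \<epsilon> * l / (2 * L\<^sup>2) * (x \<bullet> (P *v x))
      + (2 * L\<^sup>2 * g\<^sup>2 + \<epsilon> * l) / (\<epsilon> * l\<^sup>2) * (norm w)\<^sup>2"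
    using state by simp
  finally show "(?y + w) \<bullet> (P *v (?y + w))
      \<le> (1 - \<epsilon> * lambda_min \<Gamma> / (2 * (lambda_max \<Gamma>)\<^sup>2)) * (x \<bullet> (P *v x))
        + (2 * (lambda_max \<Gamma>)\<^sup>2 * g\<^sup>2 + \<epsilon> * lambda_min \<Gamma>) / (\<epsilon> * (lambda_min \<Gamma>)\<^sup>2) * (norm w)\<^sup>2"
    by (simp add: l_def L_def left_diff_distrib)
qed

section \<open>Assembly of the estimate\<close>

theorem theorem5:
  fixes X :: "(real^'n) set"
    and A :: "real^'n \<Rightarrow> real^'n^'n"
    and B :: "real^'n \<Rightarrow> real^'m^'n"
    and blkA :: "'a::finite \<Rightarrow> 'n"
    and blkB :: "'b::finite \<Rightarrow> 'm"
    and \<xi>A :: "real^'n \<Rightarrow> real^'a"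
    and \<xi>B :: "real^'n \<Rightarrow> real^'b"
    and EA :: "real^'a^'n"
    and EB :: "real^'b^'n"
    and time :: "'t::finite \<Rightarrow> nat"
    and xd :: "nat \<Rightarrow> real^'n"
    and ud :: "nat \<Rightarrow> real^'m"
    and d :: "nat \<Rightarrow> real^'n"
    and X0 :: "real^'t^'a"
    and U0 :: "real^'t^'b"
    and X1 D0 :: "real^'t^'n"
    and \<Theta> :: "real^'n^'n"
    and AA :: "real^('a + 'b)^('a + 'b)"
    and BB :: "real^('a + 'b)^'n"
    and CC :: "real^'n^'n"
    and r \<epsilon> :: real
    and \<Gamma> :: "real^'n^'n"
    and Y K :: "real^'n^'m"
    and \<gamma>Acl \<delta>x0 \<delta>w :: real
  assumes origin: "0 \<in> X"
    and contA: "\<And>i j. continuous_on X (\<lambda>x. A x $ i $ j)"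
    and contB: "\<And>i j. continuous_on X (\<lambda>x. B x $ i $ j)"
    and A1_\<xi>A: "continuous_on X \<xi>A"
    and A1_\<xi>B: "continuous_on X \<xi>B"
    and A1_A: "column_representation X A blkA \<xi>A EA"
    and A1_B: "column_representation X B blkB \<xi>B EB"
    \<comment> \<open>the number of data points is T = CARD('t); column t of a data matrix belongs to the
        sampling instant time t\<close>
    and time: "bij_betw time UNIV {..<CARD('t)}"
    and data: "\<And>k. k < CARD('t) \<Longrightarrow>
          xd (Suc k) = EA *v (blkdiag blkA (\<xi>A (xd k)) *v xd k)
                     + EB *v (blkdiag blkB (\<xi>B (xd k)) *v ud k) + d k"
    and X0: "X0 = (\<chi> p t. (blkdiag blkA (\<xi>A (xd (time t))) *v xd (time t)) $ p)"
    and U0: "U0 = (\<chi> p t. (blkdiag blkB (\<xi>B (xd (time t))) *v ud (time t)) $ p)"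
    and X1: "X1 = (\<chi> i t. xd (Suc (time t)) $ i)"
    and D0: "D0 = (\<chi> i t. d (time t) $ i)"
    and A2_\<Theta>: "loewner_le 0 \<Theta>"
    and A2_D0: "loewner_le (D0 ** transpose D0) \<Theta>"
    and A3: "rank (vcat X0 U0) = CARD('a + 'b)"
    and AA: "AA = vcat X0 U0 ** transpose (vcat X0 U0)"
    and BB: "BB = - (X1 ** transpose (vcat X0 U0))"
    and CC: "CC = X1 ** transpose X1 - \<Theta>"
    and r: "r > 0"
    and ball: "cball 0 r \<subseteq> X"
    and \<Gamma>: "symmetric_mat \<Gamma>" "loewner_less 0 \<Gamma>"
    and \<epsilon>: "\<epsilon> > 0"
    and LMI: "\<And>Q. Q \<in> vertex_matrices r blkA \<xi>A blkB \<xi>B \<Longrightarrow>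
          loewner_le
            (vcat (hcat (- \<Gamma> - CC) (hcat 0 BB))
            (vcat (hcat 0 (hcat (- \<Gamma> + \<epsilon> *\<^sub>R mat 1) (- (transpose (vcat \<Gamma> Y) ** transpose Q))))
                  (hcat (transpose BB) (hcat (- (Q ** vcat \<Gamma> Y)) (- AA)))))
            0"
    and K: "K = Y ** matrix_inv \<Gamma>"
    and \<gamma>Acl: "\<gamma>Acl = (SUP x\<in>cball 0 r. onorm (\<lambda>v. (A x + B x ** K) *v v))"
    and \<delta>x0: "\<delta>x0 = (2 * (lambda_max \<Gamma>)^2 - \<epsilon> * lambda_min \<Gamma>)
                     / (2 * lambda_min \<Gamma> * lambda_max \<Gamma>)"
    and \<delta>w: "\<delta>w = (4 * \<gamma>Acl^2 * (lambda_max \<Gamma>)^5 + 2 * \<epsilon> * lambda_min \<Gamma> * (lambda_max \<Gamma>)^3)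
                   / (\<epsilon>^2 * (lambda_min \<Gamma>)^3)"
  shows "\<exists>\<beta> \<gamma>. class_KL \<beta> \<and> class_K \<gamma> \<and>
    (\<forall>x w. bounded (range w) \<and>
           (norm (x 0))^2 \<le> r^2 \<and>
           \<delta>x0 * (norm (x 0))^2 + \<delta>w * (sup_norm w)^2 \<le> r^2 \<and>
           (\<forall>k. x (Suc k) = (A (x k) + B (x k) ** K) *v x k + w k)
       \<longrightarrow> (\<forall>k. x k \<in> X \<and> norm (x k) \<le> \<beta> (norm (x 0)) (real k) + \<gamma> (sup_norm w)))"
proof -
  define Z where "Z = hcat EA EB"
  have X1_eq: "X1 = Z ** vcat X0 U0 + D0"
  proof -
    have "X1 $ i $ t = (Z ** vcat X0 U0 + D0) $ i $ t" for i t
    proof -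
      have "time t < CARD('t)" using time by (auto simp: bij_betw_def)
      from data[OF this] show ?thesis
        unfolding X1 X0 U0 D0 Z_def
        by (simp add: matrix_matrix_mult_def sum_UNIV_Plus hcat_def vcat_def
            matrix_vector_mult_def[of EA] matrix_vector_mult_def[of EB])
    qed
    then show ?thesis by (simp add: vec_eq_iff)
  qed
  have inv: "invertible \<Gamma>"
  proof -
    have "x = 0" if "\<Gamma> *v x = 0" for x
      using \<Gamma>(2) that unfolding loewner_less_def by (metis diff_zero inner_zero_right less_irrefl)
    then show ?thesis
      by (simp add: invertible_left_inverse matrix_left_invertible_ker)
  qed
  let ?P = "matrix_inv \<Gamma>"
  have P: "\<Gamma> ** ?P = mat 1" "?P ** \<Gamma> = mat 1"
    using inv someI_ex[of "\<lambda>P. \<Gamma> ** P = mat 1 \<and> P ** \<Gamma> = mat 1"]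
    unfolding invertible_def matrix_inv_def by auto
  \<comment> \<open>Evaluating at \<open>\<Gamma> *v b\<close> removes the inverse from the gain;
    this is why the inequality is stated with \<open>vcat \<Gamma> Y\<close>.\<close>
  have K\<Gamma>: "K *v (\<Gamma> *v b) = Y *v b" for b
    by (simp add: K matrix_vector_mul_assoc P flip: matrix_mul_assoc)

  have test: "2 * (a \<bullet> ((A x + B x ** K) *v (\<Gamma> *v b)))
      \<le> a \<bullet> (\<Gamma> *v a) + b \<bullet> (\<Gamma> *v b) - \<epsilon> * (b \<bullet> b)" if x: "x \<in> cball 0 r" for x a b
  proof -
    \<comment> \<open>The functional splits into a state part and an input part, and the vertex set
      is a product, so the two vertex vectors are chosen separately, depending on \<open>x\<close>,
      \<open>a\<close> and \<open>b\<close>.\<close>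
    obtain \<zeta>A where \<zeta>A: "\<zeta>A \<in> vertex_vectors r \<xi>A"
      "(transpose EA *v a) \<bullet> (blkdiag blkA (\<xi>A x) *v (\<Gamma> *v b))
        \<le> (transpose EA *v a) \<bullet> (blkdiag blkA \<zeta>A *v (\<Gamma> *v b))"
      using vertex_dominates[OF A1_\<xi>A ball x] by blast
    obtain \<zeta>B where \<zeta>B: "\<zeta>B \<in> vertex_vectors r \<xi>B"
      "(transpose EB *v a) \<bullet> (blkdiag blkB (\<xi>B x) *v (Y *v b))
        \<le> (transpose EB *v a) \<bullet> (blkdiag blkB \<zeta>B *v (Y *v b))"
      using vertex_dominates[OF A1_\<xi>B ball x] by blast
    define Q where "Q = vcat (hcat (blkdiag blkA \<zeta>A) (0::real^'m^'a))
      (hcat (0::real^'n^'b) (blkdiag blkB \<zeta>B))"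
    have "Q \<in> vertex_matrices r blkA \<xi>A blkB \<xi>B"
      unfolding vertex_matrices_def Q_def using \<zeta>A(1) \<zeta>B(1) by blast
    from lmi_test_vector[OF X1_eq A2_D0 LMI[OF this, unfolded AA BB CC], of a b]
    have "2 * (a \<bullet> (EA *v (blkdiag blkA \<zeta>A *v (\<Gamma> *v b)))
             + a \<bullet> (EB *v (blkdiag blkB \<zeta>B *v (Y *v b))))
        \<le> a \<bullet> (\<Gamma> *v a) + b \<bullet> (\<Gamma> *v b) - \<epsilon> * (b \<bullet> b)"
      by (simp add: Z_def Q_def inner_add_right)
    moreover have "x \<in> X" using x ball by blast
    then have "(A x + B x ** K) *v (\<Gamma> *v b)
        = EA *v (blkdiag blkA (\<xi>A x) *v (\<Gamma> *v b)) + EB *v (blkdiag blkB (\<xi>B x) *v (Y *v b))"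
      using column_representation_eq[OF A1_A] column_representation_eq[OF A1_B]
      by (simp add: matrix_vector_mult_add_rdistrib K\<Gamma> flip: matrix_vector_mul_assoc)
    ultimately show ?thesis
      using \<zeta>A(2) \<zeta>B(2) by (simp add: inner_add_right inner_transpose_mult)
  qed

  define l L where "l = lambda_min \<Gamma>" and "L = lambda_max \<Gamma>"
  have "l \<le> L" unfolding l_def L_def by (rule lambda_min_le_lambda_max[OF \<Gamma>(1)])
  \<comment> \<open>Testing with \<open>a = 0\<close> and an eigenvector of the least eigenvalue
    bounds the margin \<open>\<epsilon>\<close> by \<open>l\<close>. This gives \<open>0 < l\<close>
    and later \<open>0 < \<rho>\<close>.\<close>
  have "\<epsilon> \<le> l"
  proof -
    obtain v where v: "v \<noteq> 0" "\<Gamma> *v v = l *\<^sub>R v"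
      unfolding l_def using lambda_min_attained[OF \<Gamma>(1)] by blast
    from test[of 0 0 v] r v have "\<epsilon> * (v \<bullet> v) \<le> l * (v \<bullet> v)" by simp
    with v(1) show ?thesis by simp
  qed
  with \<epsilon> have l: "0 < l" by simp
  with \<open>l \<le> L\<close> have L: "0 < L" by simp
  define \<rho> where "\<rho> = 1 - \<epsilon> * l / (2 * L\<^sup>2)"
  have "\<epsilon> * l \<le> L * L" using \<epsilon> \<open>\<epsilon> \<le> l\<close> \<open>l \<le> L\<close> l by (intro mult_mono) auto
  then have \<rho>: "0 < \<rho>" "\<rho> < 1"
    using \<epsilon> l L by (simp_all add: \<rho>_def power2_eq_square)
      (smt (verit) mult_pos_pos)
  define c where "c = (2 * L\<^sup>2 * \<gamma>Acl\<^sup>2 + \<epsilon> * l) / (\<epsilon> * l\<^sup>2)"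
  have c: "0 < c" unfolding c_def using \<epsilon> l
    by (intro divide_pos_pos add_nonneg_pos) auto
  \<comment> \<open>The constants of the theorem are matched with those of the abstract recursion
    for \<open>\<alpha>1 = 1 / L\<close> and \<open>\<alpha>2 = 1 / l\<close>.\<close>
  have \<delta>x0_eq: "\<delta>x0 = \<rho> * (1 / l) / (1 / L)"
    unfolding \<delta>x0 \<rho>_def using l L by (simp add: field_simps power2_eq_square flip: l_def L_def)
  have \<delta>w_eq: "\<delta>w = c / ((1 - \<rho>) * (1 / L))"
    unfolding \<delta>w \<rho>_def c_def using l L \<epsilon>
    by (simp add: field_simps power2_eq_square power3_eq_cube power_numeral_reduce
        flip: l_def L_def)
  have \<delta>w_pos: "0 < \<delta>w" unfolding \<delta>w_eq using c \<rho> L by simp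

  have Acl: "norm ((A x + B x ** K) *v v) \<le> \<gamma>Acl * norm v" if "x \<in> cball 0 r" for x v
  proof -
    have "bdd_above ((\<lambda>x. onorm (\<lambda>v. (A x + B x ** K) *v v)) ` cball 0 r)"
    proof (rule bdd_above_onorm_image)
      fix i j
      show "continuous_on (cball 0 r) (\<lambda>x. (A x + B x ** K) $ i $ j)"
        unfolding matrix_matrix_mult_def
        by (simp, intro continuous_intros continuous_on_subset[OF contA ball]
            continuous_on_subset[OF contB ball])
    qed simp
    then have "onorm (\<lambda>v. (A x + B x ** K) *v v) \<le> \<gamma>Acl"
      unfolding \<gamma>Acl using that by (rule cSUP_upper[rotated])
    moreover have "norm ((A x + B x ** K) *v v) \<le> onorm (\<lambda>v. (A x + B x ** K) *v v) * norm v"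
      by (rule onorm) (rule matrix_vector_mul_bounded_linear)
    ultimately show ?thesis by (meson mult_right_mono norm_ge_zero order_trans)
  qed
  note lyap = lyapunov_decrease[OF \<Gamma>(1) l[unfolded l_def] \<epsilon> P(1) test Acl, folded l_def L_def,
      folded \<rho>_def c_def]

  \<comment> \<open>The recursion bounds squared norms, so both gains are square roots of its
    coefficients.\<close>
  define \<beta> where "\<beta> = (\<lambda>s t. sqrt (L / l) * sqrt \<rho> powr t * s)"
  define \<gamma> where "\<gamma> = (\<lambda>s. sqrt \<delta>w * s)"
  have "class_KL \<beta>" unfolding \<beta>_def using l L \<rho> by (intro class_KL_exponential) auto
  moreover have "class_K \<gamma>" unfolding \<gamma>_def using \<delta>w_pos by (intro class_K_linear) simp
  moreover have "x k \<in> X \<and> norm (x k) \<le> \<beta> (norm (x 0)) (real k) + \<gamma> (sup_norm w)"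
    if bounded: "bounded (range w)" and x0: "(norm (x 0))\<^sup>2 \<le> r\<^sup>2"
      and small: "\<delta>x0 * (norm (x 0))\<^sup>2 + \<delta>w * (sup_norm w)\<^sup>2 \<le> r\<^sup>2"
      and step: "\<And>k. x (Suc k) = (A (x k) + B (x k) ** K) *v x k + w k" for x w k
  proof -
    have w: "norm (w k) \<le> sup_norm w" for k
      unfolding sup_norm_def
      using bounded by (intro cSUP_upper bounded_imp_bdd_above) (auto simp: bounded_iff)
    then have w0: "0 \<le> sup_norm w" using norm_ge_zero order_trans by blast
    have "norm (x 0) \<le> r" using x0 by (rule power2_le_imp_le) (use r in simp)
    then have est: "norm (x k) \<le> r \<and> (norm (x k))\<^sup>2
        \<le> ((1 / l) / (1 / L)) * \<rho> ^ k * (norm (x 0))\<^sup>2 + (c / ((1 - \<rho>) * (1 / L))) * (sup_norm w)\<^sup>2"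
    proof (intro ball_invariance_and_iss_estimate[where V = "\<lambda>v. v \<bullet> (?P *v v)"])
      show "1 / L * (norm v)\<^sup>2 \<le> v \<bullet> (?P *v v)" "v \<bullet> (?P *v v) \<le> 1 / l * (norm v)\<^sup>2" for v
        using lyap(1,2)[of 0 v] r by simp_all
      show "x (Suc k) \<bullet> (?P *v x (Suc k)) \<le> \<rho> * (x k \<bullet> (?P *v x k)) + c * (norm (w k))\<^sup>2"
        if "norm (x k) \<le> r" for k
        unfolding step using lyap(3)[of "x k"] that by simp
    qed (use L \<rho> c w r small in \<open>auto simp: \<delta>x0_eq \<delta>w_eq\<close>)
    have \<beta>: "(\<beta> (norm (x 0)) (real k))\<^sup>2 = ((1 / l) / (1 / L)) * \<rho> ^ k * (norm (x 0))\<^sup>2"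
      unfolding \<beta>_def using \<rho> l L
      by (simp add: powr_realpow power_mult_distrib flip: power_mult)
        (simp add: power_mult power_mult_distrib mult.commute[of k])
    have \<gamma>: "(\<gamma> (sup_norm w))\<^sup>2 = (c / ((1 - \<rho>) * (1 / L))) * (sup_norm w)\<^sup>2"
      unfolding \<gamma>_def \<delta>w_eq[symmetric] using \<delta>w_pos by (simp add: power_mult_distrib)
    have nonneg: "0 \<le> \<beta> (norm (x 0)) (real k)" "0 \<le> \<gamma> (sup_norm w)"
      unfolding \<beta>_def \<gamma>_def using l L \<delta>w_pos w0 by simp_all
    have "(norm (x k))\<^sup>2 \<le> (\<beta> (norm (x 0)) (real k))\<^sup>2 + (\<gamma> (sup_norm w))\<^sup>2"
      unfolding \<beta> \<gamma> using est by blast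
    \<comment> \<open>Adding the nonnegative mixed term completes the square.\<close>
    also have "\<dots> \<le> (\<beta> (norm (x 0)) (real k) + \<gamma> (sup_norm w))\<^sup>2"
      using nonneg by (simp add: power2_sum)
    finally have "norm (x k) \<le> \<beta> (norm (x 0)) (real k) + \<gamma> (sup_norm w)"
      by (rule power2_le_imp_le) (use nonneg in simp)
    moreover have "x k \<in> X" using est ball by (auto simp: subset_iff)
    ultimately show ?thesis by blast
  qed
  ultimately show ?thesis by blast
qed

end
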